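(* For every integer $n\ge 2$, let $Q(n)$ be the maximum cardinality of a family of Hamilton paths of the complete graph $K_n$ in which any two distinct paths are crossing. Then $$\frac{(\lfloor n/2 \rfloor -1)!}{2^{\lfloor n/4 \rfloor }}\leq Q(n).$$
   Context: $K_n$ is the (undirected) complete graph with vertex set $[n]=\{1,2,\dots,n\}$. A Hamilton path of $K_n$ is regarded as an (undirected) subgraph of $K_n$. The union of two graphs on the same vertex set is the graph on that vertex set whose edge set is the union of their edge sets. Two Hamilton paths of $K_n$ are called crossing if their union has (maximum) degree $4$, i.e. some vertex of $[n]$ has degree $4$ in their union. *)

theory Defs
  imports Complex_Main
begin

text \<open>A finite simple undirected graph is a pair of a vertex set and a set of edges, each edge
being a two-element set of vertices.\<close>

type_synonym 'a ugraph = "'a set \<times> 'a set set"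

abbreviation verts :: "'a ugraph \<Rightarrow> 'a set" where
  "verts G \<equiv> fst G"

abbreviation edges :: "'a ugraph \<Rightarrow> 'a set set" where
  "edges G \<equiv> snd G"

definition complete_graph :: "nat \<Rightarrow> nat ugraph" where
  "complete_graph n = ({1..n}, {e. e \<subseteq> {1..n} \<and> card e = 2})"

definition subgraph :: "'a ugraph \<Rightarrow> 'a ugraph \<Rightarrow> bool" where
  "subgraph H G \<longleftrightarrow> verts H \<subseteq> verts G \<and> edges H \<subseteq> edges G"

definition graph_union :: "'a ugraph \<Rightarrow> 'a ugraph \<Rightarrow> 'a ugraph" where
  "graph_union G H = (verts G \<union> verts H, edges G \<union> edges H)"

definition vertex_degree :: "'a ugraph \<Rightarrow> 'a \<Rightarrow> nat" where
  "vertex_degree G v = card {e \<in> edges G. v \<in> e}"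

definition max_degree :: "'a ugraph \<Rightarrow> nat" where
  "max_degree G = Max (vertex_degree G ` verts G)"

definition path_graph :: "'a list \<Rightarrow> 'a ugraph" where
  "path_graph xs = (set xs, {{xs ! i, xs ! Suc i} | i. Suc i < length xs})"

text \<open>A path is an undirected graph, not a sequence: a list of distinct vertices and its
reversal give the same path.\<close>

definition is_path :: "'a ugraph \<Rightarrow> bool" where
  "is_path P \<longleftrightarrow> (\<exists>xs. xs \<noteq> [] \<and> distinct xs \<and> P = path_graph xs)"

definition hamilton_path :: "'a ugraph \<Rightarrow> 'a ugraph \<Rightarrow> bool" where
  "hamilton_path G P \<longleftrightarrow> is_path P \<and> subgraph P G \<and> verts P = verts G"

definition crossing :: "'a ugraph \<Rightarrow> 'a ugraph \<Rightarrow> bool" where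
  "crossing P P' \<longleftrightarrow> max_degree (graph_union P P') = 4"

definition crossing_families :: "nat \<Rightarrow> nat ugraph set set" where
  "crossing_families n =
     {F. (\<forall>P\<in>F. hamilton_path (complete_graph n) P) \<and> pairwise crossing F}"

definition Q :: "nat \<Rightarrow> nat" where
  "Q n = Max (card ` crossing_families n)"

text \<open>The maximum in the definition of \<open>Q\<close> is taken over a finite nonempty set of finite
families.\<close>

lemma finite_hamilton_paths: "finite {P. hamilton_path (complete_graph n) P}"
proof (rule finite_subset)
  show "{P. hamilton_path (complete_graph n) P} \<subseteq> Pow {1..n} \<times> Pow (Pow {1..n})"
    by (auto simp: hamilton_path_def subgraph_def complete_graph_def)
qed simp

lemma finite_crossing_families: "finite (crossing_families n)"
  by (rule finite_subset[of _ "Pow {P. hamilton_path (complete_graph n) P}"])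
    (auto simp: crossing_families_def finite_hamilton_paths)

lemma finite_crossing_family: "F \<in> crossing_families n \<Longrightarrow> finite F"
  by (rule finite_subset[OF _ finite_hamilton_paths[of n]])
    (auto simp: crossing_families_def)

lemma crossing_families_nonempty: "crossing_families n \<noteq> {}"
proof -
  have "{} \<in> crossing_families n"
    by (simp add: crossing_families_def)
  then show ?thesis by blast
qed

lemma crossing_iff_ex_degree_4:
  assumes "hamilton_path (complete_graph n) P" "hamilton_path (complete_graph n) P'"
  shows "crossing P P' \<longleftrightarrow> (\<exists>v\<in>{1..n}. vertex_degree (graph_union P P') v = 4)"
proof -
  have deg2: "finite {e \<in> edges R. v \<in> e} \<and> card {e \<in> edges R. v \<in> e} \<le> 2"
    if "hamilton_path (complete_graph n) R" for R :: "nat ugraph" and v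
  proof -
    from that obtain xs where xs: "distinct xs" "R = path_graph xs"
      by (auto simp: hamilton_path_def is_path_def)
    have "\<exists>k. {e \<in> edges R. v \<in> e} \<subseteq> {{xs ! k, xs ! Suc k}, {xs ! (k - 1), xs ! k}}"
    proof (cases "v \<in> set xs")
      case True
      then obtain k where k: "k < length xs" "xs ! k = v"
        by (auto simp: in_set_conv_nth)
      have "e \<in> {{xs ! k, xs ! Suc k}, {xs ! (k - 1), xs ! k}}"
        if "e \<in> edges R" "v \<in> e" for e
      proof -
        from that xs obtain i where i: "Suc i < length xs" "e = {xs ! i, xs ! Suc i}"
          by (auto simp: path_graph_def)
        with that k have "xs ! k = xs ! i \<or> xs ! k = xs ! Suc i" by auto
        with i k xs(1) have "k = i \<or> k = Suc i"
          by (metis Suc_lessD nth_eq_iff_index_eq)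
        with i show ?thesis by auto
      qed
      then show ?thesis by (intro exI[of _ k]) blast
    next
      case False
      with xs have "{e \<in> edges R. v \<in> e} = {}"
        by (auto simp: path_graph_def)
      then show ?thesis by (metis empty_subsetI)
    qed
    then obtain k where k: "{e \<in> edges R. v \<in> e} \<subseteq> {{xs ! k, xs ! Suc k}, {xs ! (k - 1), xs ! k}}" ..
    have "card {e \<in> edges R. v \<in> e} \<le> card {{xs ! k, xs ! Suc k}, {xs ! (k - 1), xs ! k}}"
      using k by (intro card_mono) auto
    also have "\<dots> \<le> 2" by (simp add: card_insert_if)
    finally show ?thesis using k finite_subset by blast
  qed
  let ?U = "graph_union P P'"
  have V: "verts ?U = {1..n}"
    using assms by (simp add: graph_union_def hamilton_path_def complete_graph_def)
  have le: "vertex_degree ?U v \<le> 4" for v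
  proof -
    have "{e \<in> edges ?U. v \<in> e} = {e \<in> edges P. v \<in> e} \<union> {e \<in> edges P'. v \<in> e}"
      by (auto simp: graph_union_def)
    then have "vertex_degree ?U v \<le> card {e \<in> edges P. v \<in> e} + card {e \<in> edges P'. v \<in> e}"
      by (simp add: vertex_degree_def card_Un_le)
    then show ?thesis using deg2[OF assms(1), of v] deg2[OF assms(2), of v] by linarith
  qed
  have "verts P \<noteq> {}"
    using assms(1) by (auto simp: hamilton_path_def is_path_def path_graph_def)
  then have ne: "{1..n} \<noteq> {}"
    using assms(1) by (simp add: hamilton_path_def complete_graph_def)
  show ?thesis unfolding crossing_def max_degree_def V
    using ne le by (subst Max_eq_iff) auto
qed

end

theory Submission
  imports Defs "HOL-Combinatorics.Permutations"
begin

text \<open>Let \<open>k = n div 2 - 1\<close>. A permutation \<open>\<sigma>\<close> of \<open>{0,\<dots>,k-1}\<close> gives the Hamilton path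
\<open>a\<^sub>0, b\<^bsub>\<sigma> 0\<^esub>, a\<^sub>1, b\<^bsub>\<sigma> 1\<^esub>, a\<^sub>2, \<dots>, a\<^sub>k\<close> in which the \<open>a\<^sub>p\<close> keep a fixed order, followed by one or
two left-over vertices. Every \<open>b\<close> is an inner vertex. The paths of \<open>\<sigma>\<close> and \<open>\<tau>\<close> cross as soon as
some inner vertex has disjoint neighbourhoods in them. At \<open>b\<^sub>v\<close> this says that \<open>v\<close> occurs in \<open>\<sigma>\<close> and in
\<open>\<tau>\<close> at positions differing by at least 2; at \<open>a\<^bsub>p+1\<^esub>\<close> it says that positions \<open>p, p+1\<close> carry disjoint
pairs of values in \<open>\<sigma>\<close> and in \<open>\<tau>\<close>.

If neither happens for \<open>\<sigma> \<noteq> \<tau>\<close>, then at the first position \<open>i\<close> where they differ the values at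
\<open>i\<close> and \<open>i+1\<close> are exchanged, and the value at \<open>i+2\<close> is common, because otherwise the pairs of values at
\<open>i+1, i+2\<close> would be disjoint. Hence in the window of positions
\<open>2j, 2j+1, 2j+2\<close> with \<open>j = i div 2\<close>, which contains \<open>i\<close> and \<open>i+1\<close> and ends at the latest at
\<open>i+2\<close>, the two permutations differ by exactly one transposition, so the patterns they show there have
opposite signs (\<open>locally_separated_if_same_windows\<close>). Consequently any two permutations with
the same signs in all \<open>k div 2\<close> windows give crossing paths, and by the pigeonhole principle some sign vector
is shared by at least \<open>k! / 2 ^ (k div 2)\<close> permutations.\<close>

section \<open>Crossing paths\<close>

lemma path_edges_at_inner_vertex:
  assumes "distinct xs" "0 < t" "Suc t < length xs"
  shows "{e \<in> edges (path_graph xs). xs ! t \<in> e}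
    = {{xs ! t, xs ! (t - 1)}, {xs ! t, xs ! Suc t}}" (is "?L = ?R")
proof
  show "?L \<subseteq> ?R"
  proof
    fix e assume "e \<in> ?L"
    then obtain i where i: "Suc i < length xs" "e = {xs ! i, xs ! Suc i}" "xs ! t \<in> e"
      by (auto simp: path_graph_def)
    then have "t = i \<or> t = Suc i"
      using assms by (auto simp: nth_eq_iff_index_eq)
    with i show "e \<in> ?R" by auto
  qed
  have "Suc (t - 1) = t" using assms(2) by simp
  then have "{xs ! t, xs ! (t - 1)} \<in> edges (path_graph xs)"
    using assms(3) by (auto simp: path_graph_def intro!: exI[of _ "t - 1"])
  moreover have "{xs ! t, xs ! Suc t} \<in> edges (path_graph xs)"
    using assms(3) by (auto simp: path_graph_def)
  ultimately show "?R \<subseteq> ?L" by auto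
qed

lemma hamilton_path_path_graph:
  assumes "distinct xs" "xs \<noteq> []" "set xs = {1..n}"
  shows "hamilton_path (complete_graph n) (path_graph xs)"
proof -
  have "e \<subseteq> {1..n} \<and> card e = 2" if "e \<in> edges (path_graph xs)" for e
  proof -
    from that obtain i where i: "Suc i < length xs" "e = {xs ! i, xs ! Suc i}"
      by (auto simp: path_graph_def)
    then have "xs ! i \<noteq> xs ! Suc i" using assms(1) by (simp add: nth_eq_iff_index_eq)
    moreover have "xs ! i \<in> {1..n}" "xs ! Suc i \<in> {1..n}"
      using i(1) unfolding assms(3)[symmetric] by (simp_all add: Suc_lessD)
    ultimately show ?thesis using i(2) by simp
  qed
  moreover have "verts (path_graph xs) = {1..n}"
    using assms(3) by (simp add: path_graph_def)
  ultimately show ?thesis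
    using assms(1,2) unfolding hamilton_path_def is_path_def subgraph_def complete_graph_def
    by auto
qed

text \<open>Two inner edges from each path meet at the common vertex, and disjointness of the neighbour sets
makes these four edges different. The second conclusion serves to count paths instead of
permutations.\<close>

lemma crossing_if_disjoint_neighbours:
  fixes xs ys :: "nat list"
  assumes xs: "distinct xs" "set xs = {1..n}" "0 < s" "Suc s < length xs"
    and ys: "distinct ys" "set ys = {1..n}" "0 < t" "Suc t < length ys"
    and same: "xs ! s = ys ! t"
    and disj: "{xs ! (s - 1), xs ! Suc s} \<inter> {ys ! (t - 1), ys ! Suc t} = {}"
  shows "crossing (path_graph xs) (path_graph ys)" "path_graph xs \<noteq> path_graph ys"
proof -
  let ?u = "xs ! s"
  let ?U = "graph_union (path_graph xs) (path_graph ys)"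
  have ham: "hamilton_path (complete_graph n) (path_graph xs)"
    "hamilton_path (complete_graph n) (path_graph ys)"
    using assms by (auto intro!: hamilton_path_path_graph)
  have ne: "xs ! (s - 1) \<noteq> xs ! Suc s" "ys ! (t - 1) \<noteq> ys ! Suc t"
    using xs ys by (simp_all add: nth_eq_iff_index_eq)
  have X: "{e \<in> edges (path_graph xs). ?u \<in> e} = {{?u, xs ! (s - 1)}, {?u, xs ! Suc s}}"
    using xs by (intro path_edges_at_inner_vertex)
  have Y: "{e \<in> edges (path_graph ys). ?u \<in> e} = {{?u, ys ! (t - 1)}, {?u, ys ! Suc t}}"
    unfolding same using ys by (intro path_edges_at_inner_vertex)
  have "{e \<in> edges ?U. ?u \<in> e}
      = {e \<in> edges (path_graph xs). ?u \<in> e} \<union> {e \<in> edges (path_graph ys). ?u \<in> e}"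
    by (auto simp: graph_union_def)
  also have "\<dots> = {{?u, xs ! (s - 1)}, {?u, xs ! Suc s}, {?u, ys ! (t - 1)}, {?u, ys ! Suc t}}"
    unfolding X Y by auto
  also have "card \<dots> = 4"
    using ne disj by (simp add: doubleton_eq_iff)
  finally have "vertex_degree ?U ?u = 4"
    by (simp add: vertex_degree_def)
  moreover have "?u \<in> {1..n}"
    using xs(4) unfolding xs(2)[symmetric] by simp
  ultimately show "crossing (path_graph xs) (path_graph ys)"
    using crossing_iff_ex_degree_4[OF ham] by blast
  show "path_graph xs \<noteq> path_graph ys"
  proof
    assume "path_graph xs = path_graph ys"
    then have "{{?u, xs ! (s - 1)}, {?u, xs ! Suc s}} = {{?u, ys ! (t - 1)}, {?u, ys ! Suc t}}"
      using X Y by simp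
    then show False using disj by (auto simp: doubleton_eq_iff)
  qed
qed

section \<open>Locally separated permutations\<close>

text \<open>The two alternatives are the crossings at a permuted and at a fixed vertex of the interleaved
paths.\<close>

definition locally_separated :: "nat \<Rightarrow> (nat \<Rightarrow> nat) \<Rightarrow> (nat \<Rightarrow> nat) \<Rightarrow> bool" where
  "locally_separated k \<sigma> \<tau> \<longleftrightarrow>
     (\<exists>p<k. \<exists>q<k. \<sigma> p = \<tau> q \<and> (p + 2 \<le> q \<or> q + 2 \<le> p)) \<or>
     (\<exists>p. Suc p < k \<and> {\<sigma> p, \<sigma> (Suc p)} \<inter> {\<tau> p, \<tau> (Suc p)} = {})"

text \<open>The parity of the number of inversions among three consecutive positions. Neighbouring windows
share one position; this overlap lets every pair of adjacent positions lie in some window.\<close>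

definition odd_window :: "(nat \<Rightarrow> nat) \<Rightarrow> nat \<Rightarrow> bool" where
  "odd_window \<sigma> j \<longleftrightarrow>
     ((\<sigma> (2 * j) > \<sigma> (2 * j + 1)) \<noteq>
      ((\<sigma> (2 * j) > \<sigma> (2 * j + 2)) \<noteq> (\<sigma> (2 * j + 1) > \<sigma> (2 * j + 2))))"

text \<open>If the exchange is at the front of the window, the third value has to be unchanged; if it is at
the back, the first one has to be. In both cases the pattern changes by one transposition.\<close>

lemma odd_window_swap:
  assumes "inj \<sigma>" "i \<in> {2 * j, 2 * j + 1}"
    and "\<tau> i = \<sigma> (Suc i)" "\<tau> (Suc i) = \<sigma> i"
    and "\<And>p. p < i \<Longrightarrow> \<tau> p = \<sigma> p" "\<tau> (Suc (Suc i)) = \<sigma> (Suc (Suc i))"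
  shows "odd_window \<tau> j \<longleftrightarrow> \<not> odd_window \<sigma> j"
proof -
  have ne: "\<sigma> i \<noteq> \<sigma> (Suc i)" using assms(1) by (simp add: inj_eq)
  consider "i = 2 * j" | "i = 2 * j + 1" using assms(2) by auto
  then show ?thesis
  proof cases
    case 1
    then show ?thesis using ne assms(3,4,6) by (auto simp: odd_window_def)
  next
    case 2
    then have "\<tau> (2 * j) = \<sigma> (2 * j)" using assms(5) by simp
    then show ?thesis using 2 ne assms(3,4) by (auto simp: odd_window_def)
  qed
qed

text \<open>At the first difference, a value that moves by at most one position can only come from the next
position, since everything earlier agrees. This forces an exchange, and hence a sign change in the window
around it.\<close>

lemma locally_separated_if_same_windows:
  assumes \<sigma>: "\<sigma> permutes {..<k}" and \<tau>: "\<tau> permutes {..<k}" and "\<sigma> \<noteq> \<tau>"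
    and same: "\<And>j. j < k div 2 \<Longrightarrow> odd_window \<sigma> j = odd_window \<tau> j"
  shows "locally_separated k \<sigma> \<tau>"
proof (rule ccontr)
  assume nsep: "\<not> locally_separated k \<sigma> \<tau>"
  note inj = permutes_inj[OF \<sigma>] permutes_inj[OF \<tau>]
  define i where "i = (LEAST i. \<sigma> i \<noteq> \<tau> i)"
  have diff: "\<sigma> i \<noteq> \<tau> i"
    unfolding i_def by (rule LeastI_ex) (use \<open>\<sigma> \<noteq> \<tau>\<close> in blast)
  have before: "\<sigma> p = \<tau> p" if "p < i" for p
    using not_less_Least[of p "\<lambda>i. \<sigma> i \<noteq> \<tau> i"] that unfolding i_def by blast
  have fixed: "\<sigma> p = p" "\<tau> p = p" if "k \<le> p" for p
    using that permutes_not_in[OF \<sigma>] permutes_not_in[OF \<tau>] by auto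
  have "i < k" using diff fixed by (metis not_less)
  have near: "p \<le> Suc q \<and> q \<le> Suc p" if "p < k" "q < k" "\<sigma> p = \<tau> q" for p q
    using nsep that unfolding locally_separated_def by (metis add_2_eq_Suc' not_less_eq_eq)
  have \<tau>i: "\<tau> i = \<sigma> (Suc i) \<and> Suc i < k"
  proof -
    obtain p where p: "\<tau> i = \<sigma> p" by (metis \<sigma> permutes_def)
    have "\<tau> i < k" using permutes_in_image[OF \<tau>, of i] \<open>i < k\<close> by simp
    then have "p < k" using permutes_in_image[OF \<sigma>, of p] p by simp
    have "\<not> p < i" using before[of p] p inj(2) by (metis inj_eq less_irrefl)
    moreover have "p \<noteq> i" using p diff by auto
    moreover have "p \<le> Suc i" using near[of p i] p \<open>p < k\<close> \<open>i < k\<close> by simp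
    ultimately have "p = Suc i" by linarith
    then show ?thesis using p \<open>p < k\<close> by simp
  qed
  have \<sigma>i: "\<sigma> i = \<tau> (Suc i)"
  proof -
    obtain q where q: "\<sigma> i = \<tau> q" by (metis \<tau> permutes_def)
    have "\<sigma> i < k" using permutes_in_image[OF \<sigma>, of i] \<open>i < k\<close> by simp
    then have "q < k" using permutes_in_image[OF \<tau>, of q] q by simp
    have "\<not> q < i" using before[of q] q inj(1) by (metis inj_eq less_irrefl)
    moreover have "q \<noteq> i" using q diff by auto
    moreover have "q \<le> Suc i" using near[of i q] q \<open>q < k\<close> \<open>i < k\<close> by simp
    ultimately have "q = Suc i" by linarith
    then show ?thesis using q by simp
  qed
  \<comment> \<open>From position \<open>k\<close> on both permutations are the identity; this covers a last window that
    reaches position \<open>k\<close>.\<close>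
  have after: "\<sigma> (Suc (Suc i)) = \<tau> (Suc (Suc i))"
  proof (cases "Suc (Suc i) < k")
    case True
    then have "{\<sigma> (Suc i), \<sigma> (Suc (Suc i))} \<inter> {\<tau> (Suc i), \<tau> (Suc (Suc i))} \<noteq> {}"
      using nsep unfolding locally_separated_def by blast
    moreover have "\<sigma> (Suc i) \<noteq> \<tau> (Suc i)" "\<sigma> (Suc i) \<noteq> \<tau> (Suc (Suc i))"
      using \<tau>i[THEN conjunct1, symmetric] inj(2) by (simp_all add: inj_eq)
    moreover have "\<sigma> (Suc (Suc i)) \<noteq> \<tau> (Suc i)"
      using \<sigma>i[symmetric] inj(1) by (simp add: inj_eq)
    ultimately show ?thesis by blast
  qed (simp add: fixed)
  have "i \<in> {2 * (i div 2), 2 * (i div 2) + 1}" by auto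
  then have "odd_window \<tau> (i div 2) \<longleftrightarrow> \<not> odd_window \<sigma> (i div 2)"
    using odd_window_swap[OF inj(1), of i "i div 2" \<tau>] \<tau>i \<sigma>i before after by simp
  moreover have "i div 2 < k div 2" using \<tau>i by linarith
  ultimately show False using same by blast
qed

lemma pigeonhole_fibre:
  assumes "finite A" "finite B" "f ` A \<subseteq> B" "B \<noteq> {}"
  obtains b where "b \<in> B" "card A \<le> card {a \<in> A. f a = b} * card B"
proof (rule ccontr)
  assume "\<not> thesis"
  with that have less: "card {a \<in> A. f a = b} * card B < card A" if "b \<in> B" for b
    using \<open>b \<in> B\<close> not_less by blast
  have "card A = (\<Sum>b\<in>B. card {a \<in> A. f a = b})"
    using sum.group[OF assms(1-3), of "\<lambda>_. 1::nat"] by simp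
  then have "card A * card B = (\<Sum>b\<in>B. card {a \<in> A. f a = b} * card B)"
    by (simp add: sum_distrib_right)
  also have "\<dots> < (\<Sum>b\<in>B. card A)"
    using assms(2,4) less by (intro sum_strict_mono)
  finally show False by simp
qed

lemma large_locally_separated_family:
  obtains S where "S \<subseteq> {\<sigma>. \<sigma> permutes {..<k}}" "pairwise (locally_separated k) S"
    "fact k \<le> card S * 2 ^ (k div 2)"
proof -
  let ?A = "{\<sigma>. \<sigma> permutes {..<k}}" and ?B = "Pow {..<k div 2}"
  let ?f = "\<lambda>\<sigma>. {j. j < k div 2 \<and> odd_window \<sigma> j}"
  have fin: "finite ?A" "finite ?B" by (simp_all add: finite_permutations)
  have "?f ` ?A \<subseteq> ?B" "?B \<noteq> {}" by auto
  from pigeonhole_fibre[OF fin this]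
  obtain W where W: "card ?A \<le> card {\<sigma> \<in> ?A. ?f \<sigma> = W} * card ?B" .
  let ?S = "{\<sigma> \<in> ?A. ?f \<sigma> = W}"
  have "locally_separated k \<sigma> \<tau>" if "\<sigma> \<in> ?S" "\<tau> \<in> ?S" "\<sigma> \<noteq> \<tau>" for \<sigma> \<tau>
  proof (rule locally_separated_if_same_windows)
    have "?f \<sigma> = ?f \<tau>" using that by simp
    then show "odd_window \<sigma> j = odd_window \<tau> j" if "j < k div 2" for j
      using that by blast
  qed (use that in auto)
  then have "pairwise (locally_separated k) ?S"
    by (simp add: pairwise_def)
  moreover have "fact k \<le> card ?S * 2 ^ (k div 2)"
    using W by (simp add: card_permutations card_Pow)
  ultimately show thesis using that[of ?S] by blast
qed

section \<open>Interleaving with a fixed sequence\<close>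

text \<open>The vertices are the positions shifted by one: the odd numbers are the fixed \<open>a\<close>s, and
\<open>2 * v + 2\<close> is \<open>b\<^sub>v\<close>. A permutation of \<open>{..<k}\<close> is the identity from \<open>k\<close> on, so the left-over vertices at
the end stay in their natural places.\<close>

definition interleaved :: "nat \<Rightarrow> (nat \<Rightarrow> nat) \<Rightarrow> nat list" where
  "interleaved n \<sigma> = map (\<lambda>t. Suc (if even t then t else 2 * \<sigma> (t div 2) + 1)) [0..<n]"

lemma interleaved_nth:
  "2 * p < n \<Longrightarrow> interleaved n \<sigma> ! (2 * p) = 2 * p + 1"
  "2 * p + 1 < n \<Longrightarrow> interleaved n \<sigma> ! (2 * p + 1) = 2 * \<sigma> p + 2"
  by (simp_all add: interleaved_def)

lemma
  assumes \<sigma>: "\<sigma> permutes {..<k}" and n: "2 * k \<le> n"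
  shows distinct_interleaved: "distinct (interleaved n \<sigma>)"
    and set_interleaved: "set (interleaved n \<sigma>) = {1..n}"
proof -
  let ?g = "\<lambda>t. if even t then t else 2 * \<sigma> (t div 2) + 1"
  have inj: "inj ?g"
  proof (rule injI)
    fix s t assume eq: "?g s = ?g t"
    then have "even (?g s) \<longleftrightarrow> even (?g t)" by simp
    then have par: "even s \<longleftrightarrow> even t" by (simp split: if_splits)
    show "s = t"
    proof (cases "even s")
      case False
      then have "\<sigma> (s div 2) = \<sigma> (t div 2)" using eq par by simp
      then have "s div 2 = t div 2" using permutes_inj[OF \<sigma>] by (simp add: inj_eq)
      then show ?thesis using False par by (metis odd_two_times_div_two_succ)
    qed (use eq par in simp)
  qed
  have bound: "?g t < n" if "t < n" for t
  proof (cases "even t \<or> k \<le> t div 2")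
    case True
    then show ?thesis using that permutes_not_in[OF \<sigma>, of "t div 2"] by auto
  next
    case False
    then have "\<sigma> (t div 2) < k" using permutes_in_image[OF \<sigma>, of "t div 2"] by simp
    then show ?thesis using False n by simp
  qed
  have "?g ` {..<n} \<subseteq> {..<n}"
    by (rule image_subsetI) (simp only: lessThan_iff bound)
  then have "?g ` {..<n} = {..<n}"
    using inj_on_subset[OF inj] by (intro endo_inj_surj) simp_all
  moreover have "set (interleaved n \<sigma>) = Suc ` ?g ` {..<n}"
    by (simp only: interleaved_def set_map set_upt image_image lessThan_atLeast0)
  ultimately show "set (interleaved n \<sigma>) = {1..n}"
    by (simp add: image_Suc_lessThan)
  have "inj_on (\<lambda>t. Suc (?g t)) {0..<n}"
    by (rule inj_onI, rule injD[OF inj], rule Suc_inject)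
  then show "distinct (interleaved n \<sigma>)"
    by (simp only: interleaved_def distinct_map distinct_upt set_upt simp_thms)
qed

text \<open>The hypothesis \<open>2 * k < n\<close> gives every permuted vertex, the last one included, a fixed
neighbour on both sides and keeps it away from the ends of the path.\<close>

lemma crossing_interleaved:
  assumes \<sigma>: "\<sigma> permutes {..<k}" and \<tau>: "\<tau> permutes {..<k}" and n: "2 * k < n"
    and sep: "locally_separated k \<sigma> \<tau>"
  shows "crossing (path_graph (interleaved n \<sigma>)) (path_graph (interleaved n \<tau>))
    \<and> path_graph (interleaved n \<sigma>) \<noteq> path_graph (interleaved n \<tau>)"
proof -
  let ?x = "interleaved n \<sigma>" and ?y = "interleaved n \<tau>"
  have len: "length ?x = n" "length ?y = n" by (simp_all add: interleaved_def)
  have n': "2 * k \<le> n" using n by simp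
  note lists = distinct_interleaved[OF \<sigma> n'] set_interleaved[OF \<sigma> n']
    distinct_interleaved[OF \<tau> n'] set_interleaved[OF \<tau> n']
  have cross: ?thesis
    if "0 < s" "Suc s < n" "0 < t" "Suc t < n" "?x ! s = ?y ! t"
      "{?x ! (s - 1), ?x ! Suc s} \<inter> {?y ! (t - 1), ?y ! Suc t} = {}" for s t
    using crossing_if_disjoint_neighbours[of ?x n s ?y t] lists len that by simp
  from sep consider
    (far) p q where "p < k" "q < k" "\<sigma> p = \<tau> q" "p + 2 \<le> q \<or> q + 2 \<le> p"
  | (apart) p where "Suc p < k" "{\<sigma> p, \<sigma> (Suc p)} \<inter> {\<tau> p, \<tau> (Suc p)} = {}"
    unfolding locally_separated_def by blast
  then show ?thesis
  proof cases
    case far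
    \<comment> \<open>The vertex \<open>b\<^sub>v\<close> with \<open>v = \<sigma> p = \<tau> q\<close> has degree 4.\<close>
    have x: "?x ! (2 * p) = 2 * p + 1" "?x ! (2 * p + 1) = 2 * \<sigma> p + 2"
      "?x ! (2 * p + 2) = 2 * p + 3"
      using far(1) n interleaved_nth[of p n \<sigma>] interleaved_nth(1)[of "Suc p" n \<sigma>] by simp_all
    have y: "?y ! (2 * q) = 2 * q + 1" "?y ! (2 * q + 1) = 2 * \<tau> q + 2"
      "?y ! (2 * q + 2) = 2 * q + 3"
      using far(2) n interleaved_nth[of q n \<tau>] interleaved_nth(1)[of "Suc q" n \<tau>] by simp_all
    have "{2 * p + 1, 2 * p + 3} \<inter> {2 * q + 1, 2 * q + 3} = {}"
      using far(4) by auto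
    then show ?thesis
      using cross[of "2 * p + 1" "2 * q + 1"] x y far(1-3) n by simp
  next
    case apart
    \<comment> \<open>The fixed vertex between positions \<open>p\<close> and \<open>Suc p\<close> has degree 4.\<close>
    have nth: "interleaved n \<rho> ! (2 * p + 1) = 2 * \<rho> p + 2"
      "interleaved n \<rho> ! (2 * p + 2) = 2 * p + 3"
      "interleaved n \<rho> ! (2 * p + 3) = 2 * \<rho> (Suc p) + 2" for \<rho>
      using apart(1) n interleaved_nth(2)[of p n \<rho>] interleaved_nth[of "Suc p" n \<rho>]
      by (simp_all add: numeral_3_eq_3)
    have "Suc (2 * p + 2) = 2 * p + 3" "2 * p + 2 - 1 = 2 * p + 1" by simp_all
    moreover have "{2 * \<sigma> p + 2, 2 * \<sigma> (Suc p) + 2} \<inter> {2 * \<tau> p + 2, 2 * \<tau> (Suc p) + 2} = {}"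
      using apart(2) by auto
    ultimately show ?thesis
      using cross[of "2 * p + 2" "2 * p + 2"] nth apart(1) n by (simp only:) simp
  qed
qed

theorem theorem1:
  fixes n :: nat
  assumes "n \<ge> 2"
  shows "fact (n div 2 - 1) / 2 ^ (n div 4) \<le> real (Q n)"
proof -
  define k where "k = n div 2 - 1"
  have half: "n div 2 = Suc k" using assms unfolding k_def by simp
  then have n: "2 * k < n" by linarith
  have "n div 4 = Suc k div 2" using half div_mult2_eq[of n 2 2] by simp
  then have exponent: "k div 2 \<le> n div 4" by (simp add: div_le_mono)
  obtain S where S: "S \<subseteq> {\<sigma>. \<sigma> permutes {..<k}}" "pairwise (locally_separated k) S"
    and large: "fact k \<le> card S * 2 ^ (k div 2)"
    by (rule large_locally_separated_family)
  let ?P = "\<lambda>\<sigma>. path_graph (interleaved n \<sigma>)"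
  have cross: "crossing (?P \<sigma>) (?P \<tau>) \<and> ?P \<sigma> \<noteq> ?P \<tau>" if "\<sigma> \<in> S" "\<tau> \<in> S" "\<sigma> \<noteq> \<tau>" for \<sigma> \<tau>
    using crossing_interleaved[OF _ _ n, of \<sigma> \<tau>] S that by (auto simp: pairwise_def)
  have "hamilton_path (complete_graph n) (?P \<sigma>)" if "\<sigma> \<in> S" for \<sigma>
  proof (rule hamilton_path_path_graph)
    have perm: "\<sigma> permutes {..<k}" "2 * k \<le> n" using S(1) that n by auto
    show "distinct (interleaved n \<sigma>)" "set (interleaved n \<sigma>) = {1..n}"
      using distinct_interleaved[OF perm] set_interleaved[OF perm] .
    show "interleaved n \<sigma> \<noteq> []" using assms by (simp add: interleaved_def)
  qed
  moreover have "pairwise crossing (?P ` S)"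
    using cross by (auto simp: pairwise_def)
  ultimately have "?P ` S \<in> crossing_families n"
    by (auto simp: crossing_families_def)
  then have "card (?P ` S) \<le> Q n"
    unfolding Q_def by (intro Max_ge) (simp_all add: finite_crossing_families)
  moreover have "card (?P ` S) = card S"
    using cross by (intro card_image inj_onI) blast
  ultimately have "card S \<le> Q n" by simp
  have "(2::nat) ^ (k div 2) \<le> 2 ^ (n div 4)"
    using exponent by (intro power_increasing) simp_all
  with \<open>card S \<le> Q n\<close> have "card S * 2 ^ (k div 2) \<le> Q n * 2 ^ (n div 4)"
    by (rule mult_le_mono)
  with large have "fact k \<le> Q n * 2 ^ (n div 4)" by linarith
  then have "real (fact k) \<le> real (Q n * 2 ^ (n div 4))" by (rule of_nat_mono)
  then show ?thesis
    unfolding k_def[symmetric] by (simp add: divide_le_eq)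
qed

end
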